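(* Let $G$ be a graph with node set $\mathcal{V}$, let $u \in \mathcal{V}$, let $h \ge 1$ be an integer, and let $S_u$ be the local subgraph for node $u$ with neighborhood size $h$, with node set $\mathcal{V}^u = \{ w \in \mathcal{V} : d(u,w) \le h \}$. Assume $\mathcal{V} \setminus \mathcal{V}^u$ is nonempty and let node $v$ be defined as $$ v = \mathrm{argmax}_{w} \left( \{ I_{u,w} \mid w \in \mathcal{V} \setminus \mathcal{V}^u \} \right), $$ where $v$ is joined to $u$ by at least one path in $G$. For each path $\bar{t}$ between $u$ and $v$, let $D_{\mathrm{GM}}^{\bar{t}}$ be the geometric mean of the node degrees occurring on path $\bar{t}$, and let $D_{\mathrm{GM}}^{\bar{t}_*} = \min_{\bar{t}} \{ D_{\mathrm{GM}}^{\bar{t}} \}$, the minimum being over all paths $\bar{t}$ between $u$ and $v$. Then the graph influence loss $R_h(u)$ satisfies $$ R_h(u) \le \frac{C}{\left( D_{\mathrm{GM}}^{\bar{t}_*} \right)^{h+1}}, $$ where $C$ is the constant equal to $|\mathcal{V} \setminus \mathcal{V}^u|$ times the number of paths between $u$ and $v$.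
   Context: Graph: $G = (\mathcal{V}, \mathcal{E}, \mathbf{X})$ is a finite undirected simple graph with node set $\mathcal{V}$, edge set $\mathcal{E}$ and node feature vectors in $\mathbb{R}^d$. $\mathbf{A} = (a_{ij})$ is its adjacency matrix ($a_{ij} = 1$ if $i,j$ are adjacent, $0$ otherwise), $\mathbf{D}$ is the diagonal matrix of node degrees $D_{ii}$, $\mathcal{N}(i)$ is the set of neighbors of $i$, and $d(u,v)$ is the shortest path distance. Paths do not repeat nodes, so there are finitely many paths between two given nodes. The local subgraph $S_u$ of neighborhood size $h$ is the subgraph of $G$ induced by $\{ w : d(u,w) \le h \}$. GNN model: the GNN is a GCN with layer rule $\mathbf{H}^{(l+1)} = \sigma(\hat{\mathbf{A}} \mathbf{H}^{(l)} \mathbf{W}^{(l)})$, $\hat{\mathbf{A}} = \mathbf{D}^{-1}\mathbf{A}$, where it is assumed throughout that $\sigma$ is the identity function and every $\mathbf{W}^{(l)}$ is the identity matrix. The final output $\mathbf{x}_u^{(\infty)} \in \mathbb{R}^d$ of node $u$ obeys $\mathbf{x}_u^{(\infty)} = \frac{1}{D_{uu}} \sum_{i \in \mathcal{N}(u)} a_{ui}\, \mathbf{x}_i^{(\infty)}$. Node influence: $I_{u,w} = \left\Vert \partial \mathbf{x}_u^{(\infty)} / \partial \mathbf{x}_w^{(\infty)} \right\Vert$, where the norm is any (fixed) subordinate (operator) matrix norm. For $w \ne u$ the Jacobian is understood by repeatedly substituting the relation $\mathbf{x}_i^{(\infty)} = \frac{1}{D_{ii}} \sum_{j \in \mathcal{N}(i)}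 a_{ij}\, \mathbf{x}_j^{(\infty)}$ for the neighbors, the neighbors' neighbors, and so on, along paths from $u$ until $w$ is reached, and differentiating the resulting expression with respect to $\mathbf{x}_w^{(\infty)}$; only the terms belonging to the paths between $u$ and $w$ depend on $\mathbf{x}_w^{(\infty)}$. Explicitly, if a path from $u$ to $w$ visits the nodes $u = w_0, w_1, \dots, w_\ell = w$, it contributes the term $\left( \prod_{k=0}^{\ell-1} \frac{a_{w_k w_{k+1}}}{D_{w_k w_k}} \right) \mathbf{x}_w^{(\infty)}$, and the Jacobian is the $d \times d$ identity matrix multiplied by the sum of these scalar coefficients over all paths between $u$ and $w$ (zero if there is no such path). For $w = u$ the Jacobian is the identity matrix, so $I_{u,u} = 1$. Graph influence: the influence of $G$ on $u$ is $I_G(u) = \Vert [I_{u,v_1}, \dots, I_{u,v_n}] \Vert_1 = \sum_{w \in \mathcal{V}} I_{u,w}$, where $\mathcal{V} = \{v_1, \dots, v_n\}$. The influence of the local subgraph $S_u$ on $u$ is $I_{S_u}(u) = \sum_{w \in \mathcal{V}^u} I_{u,w}$, where the node influences $I_{u,w}$ are those computed in $G$. The graph influence loss is $R_h(u) = I_G(u) - I_{S_u}(u)$. Geometric mean of degrees on a path: for a path $t$ visiting $u = w_0, w_1, \dots, w_\ell = v$, $D_{\mathrm{GM}}^{t} = \left( \prod_{k=0}^{\ell-1} D_{w_k w_k} \right)^{1/\ell}$ (the $\ell$ nodes of the path other than the endpoint $v$, where $\ell$ is the length of the path). *)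

theory Defs
  imports "HOL-Analysis.Analysis" "Graph_Theory.Graph_Theory"
begin

text \<open>
  A finite undirected simple graph is a \<^locale>\<open>pair_graph\<close>: finite, symmetric, without loops or
  parallel arcs; an undirected edge is the pair of arcs \<open>(i,j)\<close>, \<open>(j,i)\<close>. Hence the degree of a
  node is its out-degree, and the paths between two nodes, which do not repeat nodes, are the
  \<open>apath\<close>s, given by their lists of arcs.
\<close>

definition adj_matrix :: "'a pair_pre_digraph \<Rightarrow> 'a \<Rightarrow> 'a \<Rightarrow> real" where
  "adj_matrix G i j = (if (i, j) \<in> parcs G then 1 else 0)"

definition degree :: "'a pair_pre_digraph \<Rightarrow> 'a \<Rightarrow> real" where
  "degree G i = real (out_degree (with_proj G) i)"

definition neighbors :: "'a pair_pre_digraph \<Rightarrow> 'a \<Rightarrow> 'a set" where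
  "neighbors G i = {j. (i, j) \<in> parcs G}"

definition paths :: "'a pair_pre_digraph \<Rightarrow> 'a \<Rightarrow> 'a \<Rightarrow> ('a \<times> 'a) list set" where
  "paths G u w = {p. pre_digraph.apath (with_proj G) u p w}"

text \<open>The shortest path distance; it is \<open>\<infinity>\<close> between different components.\<close>

definition graph_dist :: "'a pair_pre_digraph \<Rightarrow> 'a \<Rightarrow> 'a \<Rightarrow> ereal" where
  "graph_dist G u w = wf_digraph.\<mu> (with_proj G) (\<lambda>_. 1) u w"

definition local_subgraph :: "'a pair_pre_digraph \<Rightarrow> nat \<Rightarrow> 'a \<Rightarrow> ('a, 'a \<times> 'a) pre_digraph" where
  "local_subgraph G h u =
     induce_subgraph (with_proj G) {w \<in> pverts G. graph_dist G u w \<le> ereal (real h)}"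

text \<open>One layer \<open>D\<^sup>-\<^sup>1 A H\<close> of the network, the activation and all weight matrices being
  identities. The rule has no meaning at isolated nodes, so nothing is required of the output there.\<close>

definition gcn_layer :: "'a pair_pre_digraph \<Rightarrow> ('a \<Rightarrow> real ^ 'd) \<Rightarrow> 'a \<Rightarrow> real ^ 'd" where
  "gcn_layer G H i = (1 / degree G i) *\<^sub>R (\<Sum>j\<in>neighbors G i. adj_matrix G i j *\<^sub>R H j)"

definition gcn_output :: "'a pair_pre_digraph \<Rightarrow> ('a \<Rightarrow> real ^ 'd) \<Rightarrow> bool" where
  "gcn_output G x \<longleftrightarrow> (\<forall>i\<in>pverts G. degree G i \<noteq> 0 \<longrightarrow> x i = gcn_layer G x i)"

definition vector_norm :: "(real ^ 'd \<Rightarrow> real) \<Rightarrow> bool" where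
  "vector_norm N \<longleftrightarrow>
     (\<forall>y. 0 \<le> N y) \<and>
     (\<forall>y. N y = 0 \<longleftrightarrow> y = 0) \<and>
     (\<forall>c y. N (c *\<^sub>R y) = \<bar>c\<bar> * N y) \<and>
     (\<forall>y z. N (y + z) \<le> N y + N z)"

definition subordinate_norm :: "(real ^ 'd \<Rightarrow> real) \<Rightarrow> real ^ 'd ^ 'd \<Rightarrow> real" where
  "subordinate_norm N M = (SUP y\<in>-{0}. N (M *v y) / N y)"

definition path_weight :: "'a pair_pre_digraph \<Rightarrow> ('a \<times> 'a) list \<Rightarrow> real" where
  "path_weight G p = (\<Prod>(i, j)\<leftarrow>p. adj_matrix G i j / degree G i)"

text \<open>
  Repeatedly substituting the relation \<open>x i = gcn_layer G x i\<close> along the paths from \<open>u\<close> expresses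
  the output of \<open>u\<close> through other outputs; the part of that expression which depends on the output
  of \<open>w\<close> is the following one, and the Jacobian is its derivative in \<open>x w\<close>. For \<open>w = u\<close>
  the only path is the empty one, of weight 1.
\<close>

definition path_expansion :: "'a pair_pre_digraph \<Rightarrow> 'a \<Rightarrow> 'a \<Rightarrow> ('a \<Rightarrow> real ^ 'd) \<Rightarrow> real ^ 'd" where
  "path_expansion G u w x = (\<Sum>p\<in>paths G u w. path_weight G p *\<^sub>R x w)"

definition node_jacobian ::
  "'a pair_pre_digraph \<Rightarrow> ('a \<Rightarrow> real ^ 'd) \<Rightarrow> 'a \<Rightarrow> 'a \<Rightarrow> real ^ 'd ^ 'd" where
  "node_jacobian G x u w = jacobian (\<lambda>y. path_expansion G u w (x(w := y))) (at (x w))"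

definition node_influence ::
  "(real ^ 'd \<Rightarrow> real) \<Rightarrow> 'a pair_pre_digraph \<Rightarrow> ('a \<Rightarrow> real ^ 'd) \<Rightarrow> 'a \<Rightarrow> 'a \<Rightarrow> real" where
  "node_influence N G x u w = subordinate_norm N (node_jacobian G x u w)"

text \<open>The influence on \<open>u\<close> of a subgraph \<open>S\<close> of \<open>G\<close>; the node influences are those in \<open>G\<close>.\<close>

definition subgraph_influence ::
  "(real ^ 'd \<Rightarrow> real) \<Rightarrow> 'a pair_pre_digraph \<Rightarrow> ('a \<Rightarrow> real ^ 'd) \<Rightarrow>
     ('a, 'a \<times> 'a) pre_digraph \<Rightarrow> 'a \<Rightarrow> real" where
  "subgraph_influence N G x S u = (\<Sum>w\<in>verts S. node_influence N G x u w)"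

definition influence_loss ::
  "(real ^ 'd \<Rightarrow> real) \<Rightarrow> 'a pair_pre_digraph \<Rightarrow> ('a \<Rightarrow> real ^ 'd) \<Rightarrow> nat \<Rightarrow> 'a \<Rightarrow> real" where
  "influence_loss N G x h u =
     subgraph_influence N G x (with_proj G) u - subgraph_influence N G x (local_subgraph G h u) u"

text \<open>The factors range over the tails of the arcs, i.e. over all nodes except the final one.\<close>

definition degree_gm :: "'a pair_pre_digraph \<Rightarrow> ('a \<times> 'a) list \<Rightarrow> real" where
  "degree_gm G p = root (length p) (\<Prod>(i, j)\<leftarrow>p. degree G i)"

lemma node_jacobian_eq:
  "node_jacobian G x u w = (\<Sum>p\<in>paths G u w. path_weight G p) *\<^sub>R (mat 1 :: real ^ 'd ^ 'd)"
proof -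
  let ?c = "\<Sum>p\<in>paths G u w. path_weight G p"
  have "((\<lambda>y. ?c *\<^sub>R y) has_derivative (\<lambda>y. ?c *\<^sub>R y)) (at (x w))"
    by (auto intro!: derivative_eq_intros)
  then have "frechet_derivative (\<lambda>y. ?c *\<^sub>R y) (at (x w)) = (\<lambda>y. ?c *\<^sub>R y)"
    by (metis frechet_derivative_at)
  then have "node_jacobian G x u w = matrix (\<lambda>y. ?c *\<^sub>R y)"
    by (simp add: node_jacobian_def jacobian_def path_expansion_def scaleR_left.sum)
  also have "\<dots> = ?c *\<^sub>R mat 1"
    by (auto simp: matrix_def mat_def axis_def vec_eq_iff)
  finally show ?thesis .
qed

lemma subordinate_norm_scaleR_mat:
  assumes "vector_norm N"
  shows "subordinate_norm N (c *\<^sub>R (mat 1 :: real ^ 'd ^ 'd)) = \<bar>c\<bar>"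
proof -
  have *: "N ((c *\<^sub>R mat 1) *v y) / N y = \<bar>c\<bar>" if "y \<noteq> 0" for y
    using assms that
    by (simp add: vector_norm_def scaleR_matrix_vector_assoc [symmetric])
  have "(axis undefined 1 :: real ^ 'd) \<noteq> 0"
    by (simp add: axis_eq_0_iff)
  then have "(\<lambda>y. N ((c *\<^sub>R mat 1) *v y) / N y) ` (- {0}) = {\<bar>c\<bar>}"
    using * by (auto simp: image_iff)
  then show ?thesis
    by (simp add: subordinate_norm_def)
qed

lemma node_influence_self:
  assumes "pair_graph G" "u \<in> pverts G" "vector_norm N"
  shows "node_influence N G x u u = 1"
proof -
  interpret pair_graph G by fact
  have "paths G u u = {[]}"
    using assms(2) by (auto simp: paths_def apath_Nil_iff dest: apath_nonempty_ends)
  then show ?thesis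
    using subordinate_norm_scaleR_mat [OF assms(3), of 1]
    by (simp add: node_influence_def node_jacobian_eq path_weight_def)
qed

end

theory Submission
  imports Defs
begin

text \<open>
  A path \<open>p\<close> contributes exactly \<open>1 / degree_gm G p ^ length p\<close> to the influence of its end node.
  All degrees on it are at least 1, and a path leaving the local subgraph has length at least
  \<open>h + 1\<close>, so the exponent may be lowered to \<open>h + 1\<close>.
\<close>

lemma degree_ge_1:
  assumes "pair_graph G" "(i, j) \<in> parcs G"
  shows "1 \<le> degree G i"
proof -
  interpret pair_graph G by fact
  have "(i, j) \<in> out_arcs (with_proj G) i"
    using assms(2) by simp
  \<comment> \<open>The out-degree is a \<open>card\<close>, which is 0 for infinite sets too; hence
    the appeal to finiteness.\<close>
  then have "out_degree (with_proj G) i \<noteq> 0"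
    unfolding out_degree_def using finite_out_arcs by (metis card_0_eq empty_iff)
  then show ?thesis
    by (simp add: degree_def)
qed

lemma paths_arcs:
  assumes "pair_graph G" "p \<in> paths G u w"
  shows "set p \<subseteq> parcs G"
proof -
  interpret pair_graph G by fact
  show ?thesis
    using assms(2) by (auto simp: paths_def apath_def awalk_def)
qed

lemma finite_paths:
  assumes "pair_graph G"
  shows "finite (paths G u w)"
proof -
  interpret pair_graph G by fact
  show ?thesis
    unfolding paths_def by (rule apaths_finite)
qed

text \<open>A path is in particular a walk, and the distance is a minimum of walk costs with every
  arc costing 1.\<close>

lemma graph_dist_le_length:
  assumes "pair_graph G" "p \<in> paths G u w"
  shows "graph_dist G u w \<le> ereal (real (length p))"
proof -
  interpret pair_graph G by fact
  have "awalk u p w"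
    using assms(2) by (auto simp: paths_def apath_def)
  then have "graph_dist G u w \<le> ereal (awalk_cost (\<lambda>_. 1) p)"
    unfolding graph_dist_def by (rule min_cost_le_walk_cost)
  also have "awalk_cost (\<lambda>_. 1) p = real (length p)"
    by (induction p) auto
  finally show ?thesis .
qed

lemma prod_degree_ge_1:
  assumes "pair_graph G" "set p \<subseteq> parcs G"
  shows "1 \<le> (\<Prod>(i, j)\<leftarrow>p. degree G i)"
  using assms(2)
proof (induction p)
  case (Cons a p)
  then show ?case
    using degree_ge_1[OF assms(1), of "fst a" "snd a"]
    by (auto simp: case_prod_beta intro: order_trans[OF _ mult_mono[of 1 _ 1]])
qed simp

text \<open>Along arcs of \<open>G\<close> every adjacency entry is 1, so only the degrees
  remain.\<close>

lemma path_weight_eq: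
  assumes "set p \<subseteq> parcs G"
  shows "path_weight G p = 1 / (\<Prod>(i, j)\<leftarrow>p. degree G i)"
  using assms by (induction p) (auto simp: path_weight_def adj_matrix_def)

text \<open>The empty list has to be excluded: \<open>root 0\<close> is constantly 0, so its
  \<open>degree_gm\<close> is 0.\<close>

lemma degree_gm_ge_1:
  assumes "pair_graph G" "set p \<subseteq> parcs G" "p \<noteq> []"
  shows "1 \<le> degree_gm G p"
  unfolding degree_gm_def using prod_degree_ge_1[OF assms(1,2)] assms(3) by simp

lemma path_weight_eq_degree_gm:
  assumes "pair_graph G" "set p \<subseteq> parcs G" "p \<noteq> []"
  shows "path_weight G p = 1 / degree_gm G p ^ length p"
  unfolding degree_gm_def path_weight_eq[OF assms(2)]
  using prod_degree_ge_1[OF assms(1,2)] assms(3) by simp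

text \<open>The Jacobian is a multiple of the identity, whose subordinate norm is the absolute value
  of the factor. Path weights are nonnegative, so the absolute value disappears, and with it any
  dependence on \<open>N\<close> and \<open>x\<close>.\<close>

lemma node_influence_eq:
  assumes "pair_graph G" "vector_norm N"
  shows "node_influence N G x u w = (\<Sum>p\<in>paths G u w. path_weight G p)"
proof -
  have "0 \<le> path_weight G p" if "p \<in> paths G u w" for p
    using paths_arcs[OF assms(1) that] prod_degree_ge_1[OF assms(1), of p]
    by (simp add: path_weight_eq)
  then show ?thesis
    unfolding node_influence_def node_jacobian_eq subordinate_norm_scaleR_mat[OF assms(2)]
    by (simp add: sum_nonneg)
qed

lemma influence_loss_eq:
  assumes "pair_graph G"
  shows "influence_loss N G x h u
    = (\<Sum>w\<in>pverts G - verts (local_subgraph G h u). node_influence N G x u w)"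
proof -
  interpret pair_graph G by fact
  have "verts (local_subgraph G h u) \<subseteq> pverts G"
    by (auto simp: local_subgraph_def)
  then show ?thesis
    unfolding influence_loss_def subgraph_influence_def
    by (simp add: sum_diff)
qed

theorem theorem2:
  fixes G :: "'a pair_pre_digraph"
    and x :: "'a \<Rightarrow> real ^ 'd"
    and N :: "real ^ 'd \<Rightarrow> real"
    and h :: nat
    and u v :: 'a
  assumes "pair_graph G"
    and "gcn_output G x"
    and "vector_norm N"
    and "u \<in> pverts G"
    and "1 \<le> h"
    and "pverts G - verts (local_subgraph G h u) \<noteq> {}"
    and "is_arg_max (\<lambda>w. node_influence N G x u w)
           (\<lambda>w. w \<in> pverts G - verts (local_subgraph G h u)) v"
    and "paths G u v \<noteq> {}"
  shows "influence_loss N G x h u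
    \<le> real (card (pverts G - verts (local_subgraph G h u)) * card (paths G u v))
        / (Min (degree_gm G ` paths G u v)) ^ (h + 1)"
proof -
  let ?W = "pverts G - verts (local_subgraph G h u)"
  let ?P = "paths G u v"
  let ?m = "Min (degree_gm G ` ?P)"
  have max: "node_influence N G x u w \<le> node_influence N G x u v"
    if "w \<in> ?W" for w
    using assms(7) that by (auto simp: is_arg_max_def not_less)
  have fin: "finite ?P"
    by (rule finite_paths[OF assms(1)])
  have v: "v \<in> ?W"
    using assms(7) by (simp add: is_arg_max_def)
  have len: "h + 1 \<le> length p" if "p \<in> ?P" for p
  proof -
    \<comment> \<open>Since \<open>v\<close> lies outside the local subgraph this is strict; between
      integers that gains the extra 1 in the exponent. It also shows that no path to
      \<open>v\<close> is empty.\<close>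
    have "ereal (real h) < graph_dist G u v"
      using v by (auto simp: local_subgraph_def)
    also have "\<dots> \<le> ereal (real (length p))"
      by (rule graph_dist_le_length[OF assms(1) that])
    finally show ?thesis by simp
  qed
  have gm: "1 \<le> degree_gm G p" if "p \<in> ?P" for p
    using degree_gm_ge_1[OF assms(1) paths_arcs[OF assms(1) that]] len[OF that] by force
  have m: "1 \<le> ?m"
    using fin assms(8) gm by simp
  have weight: "path_weight G p \<le> 1 / ?m ^ (h + 1)" if "p \<in> ?P" for p
  proof -
    \<comment> \<open>The exponent is changed while the base is still the common minimum
      \<open>?m\<close> \<ge> 1; only then is the base replaced by the mean of \<open>p\<close>
      itself.\<close>
    have "?m ^ (h + 1) \<le> ?m ^ length p"
      using m len[OF that] by (rule power_increasing[rotated])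
    also have "\<dots> \<le> degree_gm G p ^ length p"
      using fin that m by (intro power_mono) auto
    finally have "1 / degree_gm G p ^ length p \<le> 1 / ?m ^ (h + 1)"
      using m by (intro divide_left_mono mult_pos_pos zero_less_power) (use gm[OF that] in auto)
    moreover have "path_weight G p = 1 / degree_gm G p ^ length p"
      using path_weight_eq_degree_gm[OF assms(1) paths_arcs[OF assms(1) that]] len[OF that] by force
    ultimately show ?thesis by simp
  qed
  \<comment> \<open>The constant has two sources: here each node of \<open>?W\<close> is charged the
    maximal influence, that of \<open>v\<close>; next each path to \<open>v\<close> is charged the
    maximal weight.\<close>
  have "influence_loss N G x h u \<le> real (card ?W) * node_influence N G x u v"
    unfolding influence_loss_eq[OF assms(1)] using max by (rule sum_bounded_above)
  also have "node_influence N G x u v \<le> real (card ?P) * (1 / ?m ^ (h + 1))"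
    unfolding node_influence_eq[OF assms(1,3)] using weight by (rule sum_bounded_above)
  \<comment> \<open>Chaining below a product leaves the monotonicity of multiplication by
    \<open>real (card ?W)\<close> as a premise, which \<open>mult_left_mono\<close>
    discharges.\<close>
  finally show ?thesis
    by (simp add: mult_left_mono)
qed

end
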